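(* Consider the continuous-time consecutive sequential probability ratio test (CSPRT) for the simple hypotheses $\mathscr{H}_i:\theta=\theta_i$, $i=0,1,\ldots,m-1$, described in the context. Assume that for arbitrary integer $n$ and real numbers $t_i$, $i=0,\ldots,n$, with $0=t_0<t_1<\cdots<t_{n-1}<t_n=t$, the conditional probability mass or density function of $X_{t_i}$, $i=0,1,\ldots,n-1$, given the value of $X_t$ does not depend on $\theta$. If the observational process will eventually terminate according to the stopping rule with probability $1$, then $\Pr\{\text{Reject }\mathscr{H}_i\mid\theta_i\}\le\alpha_{i+1}+\beta_i$ for $0\le i\le m-1$. Moreover, the observational process will eventually terminate according to the stopping rule with probability $1$, provided that the likelihood function $f_t(X_t;\theta)$ is unimodal with respect to $\theta\in\Theta$ for any positive number $t$, and that for arbitrary $\alpha,\beta\in(0,1)$ and $\theta\in\Theta$, $$\lim_{t\to\infty}\Pr\left\{\beta\le\Upsilon_t(X_t;\theta_{i-1},\theta_i)\le\tfrac1\alpha\;\Big|\;\theta\right\}=0,\qquad i=1,\ldots,m-1.$$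
   Context: Process. $(X_t)_{t\in[0,\infty)}$ is a right-continuous real-valued stochastic process parameterized by $\theta\in\Theta\subseteq\mathbb{R}$; $\Pr\{E\mid\theta\}$ is the probability of $E$ associated with parameter $\theta$. The probability mass or density function of $X_t$ is denoted $f_t(\cdot;\theta)$, and $f_t(x;\theta)$ is assumed right-continuous with respect to $t\in[0,\infty)$ for any $\theta\in\Theta$ and $x\in\mathbb{R}$. For $\theta',\theta''\in\Theta$, $\Upsilon_t(X_t;\theta',\theta'')=\frac{f_t(X_t;\theta'')}{f_t(X_t;\theta')}$. Unimodality. A function is unimodal with respect to $\theta\in\Theta$ if there is a number $\theta^*$ such that it is non-decreasing in $\theta\in\Theta$ no greater than $\theta^*$ and non-increasing in $\theta\in\Theta$ no less than $\theta^*$. Hypotheses and test. $m\ge2$; $\theta_0<\theta_1<\cdots<\theta_{m-1}$ are elements of $\Theta$. Fix $\alpha_i,\beta_i\in(0,1)$ for $i=1,\ldots,m-1$ and set $\alpha_m=\beta_0=0$. Continue observing $(X_t)_{t\in[0,\infty)}$ until there exists an index $j\in\{0,1,\ldots,m-1\}$ such that $\Upsilon_t(X_t;\theta_{i-1},\theta_i)>\frac1{\alpha_i}$ for $0<i\le j$ and $\Upsilon_t(X_t;\theta_{i-1},\theta_i)<\beta_i$ for $j<i<m$. At the termination of the observational procedure, accept $\mathscr{H}_j$ with the index $j$ satisfying the stopping condition; the other hypotheses are rejected. "The observational process will eventually terminate according to the stopping rule" means that the stopping condition is satisfied for some $t$; "with probability $1$" means under every $\theta\in\Theta$.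
   Formalization: Added: t ↦ f_t(X_t;θ) is right-continuous along every path (right-continuity for fixed x is not enough: changing densities at one point hit by the path breaks the bound). An undefined ratio 0/0 counts as 1, so sampling continues. *)

theory Defs
  imports "HOL-Probability.Probability"
begin

definition right_continuous :: "(real \<Rightarrow> real) \<Rightarrow> bool" where
  "right_continuous g \<longleftrightarrow> (\<forall>t\<ge>0. continuous (at_right t) g)"

definition unimodal_on :: "real set \<Rightarrow> (real \<Rightarrow> real) \<Rightarrow> bool" where
  "unimodal_on \<Theta> g \<longleftrightarrow>
     (\<exists>c. mono_on {\<theta> \<in> \<Theta>. \<theta> \<le> c} g \<and> antimono_on {\<theta> \<in> \<Theta>. c \<le> \<theta>} g)"

text \<open>The process is either discrete (its laws have mass functions) or continuous (its laws have
  Lebesgue densities).\<close>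

datatype law_kind = Discrete | Continuous

definition is_mass_function :: "'a measure \<Rightarrow> ('a \<Rightarrow> real) \<Rightarrow> (real \<Rightarrow> real) \<Rightarrow> bool" where
  "is_mass_function M Y p \<longleftrightarrow>
     Y \<in> borel_measurable M \<and>
     (\<exists>S. countable S \<and> (AE \<omega> in M. Y \<omega> \<in> S)) \<and>
     (\<forall>y. p y = \<P>(\<omega> in M. Y \<omega> = y))"

definition is_density_function :: "'a measure \<Rightarrow> ('a \<Rightarrow> real) \<Rightarrow> (real \<Rightarrow> real) \<Rightarrow> bool" where
  "is_density_function M Y p \<longleftrightarrow>
     (\<forall>y. 0 \<le> p y) \<and> distributed M lborel Y (\<lambda>y. ennreal (p y))"

fun is_mass_or_density ::
  "law_kind \<Rightarrow> 'a measure \<Rightarrow> ('a \<Rightarrow> real) \<Rightarrow> (real \<Rightarrow> real) \<Rightarrow> bool" where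
  "is_mass_or_density Discrete M Y p = is_mass_function M Y p"
| "is_mass_or_density Continuous M Y p = is_density_function M Y p"

text \<open>\<open>g v y\<close> is the conditional mass function of the vector \<open>(V 0, \<dots>, V (n - 1))\<close> at \<open>v\<close>, given
  \<open>Y = y\<close>. It is only determined where \<open>Y = y\<close> has positive probability.\<close>

definition is_cond_mass_function ::
  "'a measure \<Rightarrow> nat \<Rightarrow> (nat \<Rightarrow> 'a \<Rightarrow> real) \<Rightarrow> ('a \<Rightarrow> real)
    \<Rightarrow> ((nat \<Rightarrow> real) \<Rightarrow> real \<Rightarrow> real) \<Rightarrow> bool" where
  "is_cond_mass_function M n V Y g \<longleftrightarrow>
     (\<forall>v y. \<P>(\<omega> in M. Y \<omega> = y) > 0 \<longrightarrow>
        g v y = \<P>(\<omega> in M. (\<forall>i<n. V i \<omega> = v i) \<bar> Y \<omega> = y))"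

text \<open>\<open>g v y\<close> is a conditional density of \<open>(V 0, \<dots>, V (n - 1))\<close> at \<open>v\<close>, given \<open>Y = y\<close>, where \<open>p\<close> is
  the density of \<open>Y\<close>: the joint density is \<open>g v y * p y\<close>.\<close>

definition is_cond_density_function ::
  "'a measure \<Rightarrow> nat \<Rightarrow> (nat \<Rightarrow> 'a \<Rightarrow> real) \<Rightarrow> ('a \<Rightarrow> real) \<Rightarrow> (real \<Rightarrow> real)
    \<Rightarrow> ((nat \<Rightarrow> real) \<Rightarrow> real \<Rightarrow> real) \<Rightarrow> bool" where
  "is_cond_density_function M n V Y p g \<longleftrightarrow>
     (\<forall>v y. 0 \<le> g v y) \<and>
     (\<lambda>(v, y). g v y) \<in> borel_measurable ((\<Pi>\<^sub>M i\<in>{..<n}. lborel) \<Otimes>\<^sub>M lborel) \<and>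
     distributed M ((\<Pi>\<^sub>M i\<in>{..<n}. lborel) \<Otimes>\<^sub>M lborel)
       (\<lambda>\<omega>. ((\<lambda>i\<in>{..<n}. V i \<omega>), Y \<omega>)) (\<lambda>(v, y). ennreal (g v y * p y))"

fun is_cond_mass_or_density ::
  "law_kind \<Rightarrow> 'a measure \<Rightarrow> nat \<Rightarrow> (nat \<Rightarrow> 'a \<Rightarrow> real) \<Rightarrow> ('a \<Rightarrow> real) \<Rightarrow> (real \<Rightarrow> real)
    \<Rightarrow> ((nat \<Rightarrow> real) \<Rightarrow> real \<Rightarrow> real) \<Rightarrow> bool" where
  "is_cond_mass_or_density Discrete M n V Y p g = is_cond_mass_function M n V Y g"
| "is_cond_mass_or_density Continuous M n V Y p g = is_cond_density_function M n V Y p g"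

text \<open>One function \<open>g\<close> serves as conditional mass or density function under every parameter.\<close>

definition past_given_present_free_of_parameter ::
  "law_kind \<Rightarrow> real set \<Rightarrow> (real \<Rightarrow> 'a measure) \<Rightarrow> (real \<Rightarrow> 'a \<Rightarrow> real)
    \<Rightarrow> (real \<Rightarrow> real \<Rightarrow> real \<Rightarrow> real) \<Rightarrow> bool" where
  "past_given_present_free_of_parameter kind \<Theta> M X f \<longleftrightarrow>
     (\<forall>n\<ge>1. \<forall>s :: nat \<Rightarrow> real. s 0 = 0 \<and> (\<forall>i<n. s i < s (Suc i)) \<longrightarrow>
        (\<exists>g. \<forall>\<theta>\<in>\<Theta>. is_cond_mass_or_density kind (M \<theta>) n (\<lambda>i. X (s i)) (X (s n))
                     (\<lambda>x. f (s n) x \<theta>) g))"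

text \<open>The likelihood ratio is extended-real: a positive number over \<open>0\<close> is \<open>\<infinity>\<close>. The undefined
  quotient \<open>0 / 0\<close> carries no evidence for either parameter and is set to \<open>1\<close>, which keeps sampling
  going; setting it to \<open>0\<close> would stop in favour of one side and could break the error bound.\<close>

definition lik_ratio :: "(real \<Rightarrow> real \<Rightarrow> real \<Rightarrow> real) \<Rightarrow> real \<Rightarrow> real \<Rightarrow> real \<Rightarrow> real \<Rightarrow> ereal" where
  "lik_ratio f t x \<theta>' \<theta>'' =
     (if f t x \<theta>' = 0 \<and> f t x \<theta>'' = 0 then 1 else ereal (f t x \<theta>'') / ereal (f t x \<theta>'))"

definition stop_cond ::
  "nat \<Rightarrow> (nat \<Rightarrow> real) \<Rightarrow> (nat \<Rightarrow> real) \<Rightarrow> (nat \<Rightarrow> real) \<Rightarrow> (real \<Rightarrow> real \<Rightarrow> real \<Rightarrow> real)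
    \<Rightarrow> (real \<Rightarrow> 'a \<Rightarrow> real) \<Rightarrow> nat \<Rightarrow> real \<Rightarrow> 'a \<Rightarrow> bool" where
  "stop_cond m \<theta> \<alpha> \<beta> f X j t \<omega> \<longleftrightarrow>
     (\<forall>i. 0 < i \<and> i \<le> j \<longrightarrow> lik_ratio f t (X t \<omega>) (\<theta> (i - 1)) (\<theta> i) > ereal (1 / \<alpha> i)) \<and>
     (\<forall>i. j < i \<and> i < m \<longrightarrow> lik_ratio f t (X t \<omega>) (\<theta> (i - 1)) (\<theta> i) < ereal (\<beta> i))"

definition terminates ::
  "nat \<Rightarrow> (nat \<Rightarrow> real) \<Rightarrow> (nat \<Rightarrow> real) \<Rightarrow> (nat \<Rightarrow> real) \<Rightarrow> (real \<Rightarrow> real \<Rightarrow> real \<Rightarrow> real)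
    \<Rightarrow> (real \<Rightarrow> 'a \<Rightarrow> real) \<Rightarrow> 'a \<Rightarrow> bool" where
  "terminates m \<theta> \<alpha> \<beta> f X \<omega> \<longleftrightarrow> (\<exists>t\<ge>0. \<exists>j<m. stop_cond m \<theta> \<alpha> \<beta> f X j t \<omega>)"

definition stop_time ::
  "nat \<Rightarrow> (nat \<Rightarrow> real) \<Rightarrow> (nat \<Rightarrow> real) \<Rightarrow> (nat \<Rightarrow> real) \<Rightarrow> (real \<Rightarrow> real \<Rightarrow> real \<Rightarrow> real)
    \<Rightarrow> (real \<Rightarrow> 'a \<Rightarrow> real) \<Rightarrow> 'a \<Rightarrow> real" where
  "stop_time m \<theta> \<alpha> \<beta> f X \<omega> = Inf {t. 0 \<le> t \<and> (\<exists>j<m. stop_cond m \<theta> \<alpha> \<beta> f X j t \<omega>)}"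

text \<open>The stopping inequalities are strict, so the infimum need not be attained (a continuous
  likelihood ratio only equals its boundary there). Hence hypothesis \<open>j\<close> is accepted if its stopping
  condition holds at the stopping time or at times arbitrarily close after it.\<close>

definition accepts ::
  "nat \<Rightarrow> (nat \<Rightarrow> real) \<Rightarrow> (nat \<Rightarrow> real) \<Rightarrow> (nat \<Rightarrow> real) \<Rightarrow> (real \<Rightarrow> real \<Rightarrow> real \<Rightarrow> real)
    \<Rightarrow> (real \<Rightarrow> 'a \<Rightarrow> real) \<Rightarrow> nat \<Rightarrow> 'a \<Rightarrow> bool" where
  "accepts m \<theta> \<alpha> \<beta> f X j \<omega> \<longleftrightarrow>
     terminates m \<theta> \<alpha> \<beta> f X \<omega> \<and> j < m \<and>
     (\<forall>\<epsilon>>0. \<exists>t. stop_time m \<theta> \<alpha> \<beta> f X \<omega> \<le> t \<and> t < stop_time m \<theta> \<alpha> \<beta> f X \<omega> + \<epsilon> \<and>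
              stop_cond m \<theta> \<alpha> \<beta> f X j t \<omega>)"

definition rejects ::
  "nat \<Rightarrow> (nat \<Rightarrow> real) \<Rightarrow> (nat \<Rightarrow> real) \<Rightarrow> (nat \<Rightarrow> real) \<Rightarrow> (real \<Rightarrow> real \<Rightarrow> real \<Rightarrow> real)
    \<Rightarrow> (real \<Rightarrow> 'a \<Rightarrow> real) \<Rightarrow> nat \<Rightarrow> 'a \<Rightarrow> bool" where
  "rejects m \<theta> \<alpha> \<beta> f X i \<omega> \<longleftrightarrow> (\<exists>j. j \<noteq> i \<and> accepts m \<theta> \<alpha> \<beta> f X j \<omega>)"

end

theory Submission
  imports Defs
begin

text \<open>
  Sufficiency of the present makes a likelihood ratio of two marginal laws also the likelihood ratio
  of the whole past. If the joint mass or density of the past \<open>v\<close> and the present \<open>y\<close> is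
  \<open>g v y * f t y \<theta>\<close> with the same \<open>g\<close> for all parameters, then every event \<open>H\<close> that
  depends on finitely many observations up to time \<open>t\<close> and lies inside
  \<open>f t (X t) \<theta> < c * f t (X t) \<eta>\<close> satisfies \<open>P\<^sub>\<theta> H \<le> c * P\<^sub>\<eta> H\<close>. This is
  \<open>past_change_of_measure\<close>; it rests on summation over atoms in the discrete case and on
  integration of the joint density in the continuous one.

  Applied to the first time of a finite grid at which \<open>\<theta>\<close> is beaten in this way, and summed over
  the grid, it bounds the probability under \<open>\<theta>\<close> of ever being beaten by
  \<open>c * P\<^sub>\<eta> (\<dots>) \<le> c\<close>. A monotone limit over the positive rationals and right-continuity
  of the likelihood along the paths carry this over to all times (\<open>maximal_inequality\<close>).

  The error bound follows. If \<open>\<theta>\<^sub>i\<close> is rejected in favour of a larger index, then at some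
  time it is beaten by \<open>\<theta>\<^bsub>i+1\<^esub>\<close> with factor \<open>\<alpha>\<^bsub>i+1\<^esub>\<close>; in favour of a smaller one, it
  is beaten by \<open>\<theta>\<^bsub>i-1\<^esub>\<close> with factor \<open>\<beta>\<^sub>i\<close>. The maximal inequality bounds both
  probabilities under \<open>\<theta>\<^sub>i\<close>. The rejection event is measurable because, without the division,
  each stopping condition is a finite set of strict inequalities between right-continuous functions:
  once true it stays true for a short while, so rational times decide everything
  (\<open>accepts_iff\<close>).

  For termination, suppose that at a fixed time every consecutive ratio is conclusive, that is,
  above \<open>1 / \<alpha>\<^sub>i\<close> or below \<open>\<beta>\<^sub>i\<close>. A unimodal likelihood cannot rise again after it
  has fallen, so the conclusive ratios come in the order required by the stopping rule
  (\<open>unimodal_conclusive_stops\<close>). Not having stopped by time \<open>n\<close> thus has at most the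
  probability that some ratio is inconclusive at time \<open>n\<close>, which tends to \<open>0\<close>.
\<close>

section \<open>Change of measure given the present\<close>

lemma mass_function_nonneg: "is_mass_function M Y p \<Longrightarrow> 0 \<le> p y"
  unfolding is_mass_function_def by simp

text \<open>A mass function vanishes off a countable set.\<close>

lemma mass_function_measurable:
  assumes "is_mass_function M Y p"
  shows "p \<in> borel_measurable borel"
proof -
  from assms obtain S where Y: "Y \<in> borel_measurable M" and S: "countable S" "AE \<omega> in M. Y \<omega> \<in> S"
    and p: "\<And>y. p y = \<P>(\<omega> in M. Y \<omega> = y)"
    unfolding is_mass_function_def by blast
  have "p y = 0" if "y \<notin> S" for y
  proof -
    have "AE \<omega> in M. \<not> Y \<omega> = y" using S(2) that by (auto elim: eventually_mono)
    then have "emeasure M {\<omega> \<in> space M. Y \<omega> = y} = 0"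
      using Y by (subst (asm) AE_iff_measurable[OF _ refl]) auto
    then show ?thesis by (simp add: p measure_def)
  qed
  then show ?thesis
    using measurable_discrete_difference[of "\<lambda>_. 0 :: real" borel borel S p] S(1) by auto
qed

lemma density_function_measurable:
  assumes "is_density_function M Y p"
  shows "p \<in> borel_measurable borel"
proof -
  have "(\<lambda>y. ennreal (p y)) \<in> borel_measurable lborel" and nonneg: "\<And>y. 0 \<le> p y"
    using assms unfolding is_density_function_def distributed_def by auto
  then have "(\<lambda>y. enn2real (ennreal (p y))) \<in> borel_measurable lborel" by measurable
  then show ?thesis using nonneg by simp
qed

text \<open>Up to a null set the vector \<open>(V, Y)\<close> takes countably many values \<open>z = (v, y)\<close>, of
  probability \<open>g v y * p y\<close> and \<open>g v y * q y\<close>. The inequality between the measures is the sum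
  of the inequalities between these numbers over the atoms in \<open>C\<close>.\<close>

lemma cond_mass_function_change_of_measure:
  assumes P: "prob_space P" and Q: "prob_space Q" and sets: "sets Q = sets P"
    and V: "\<And>i. i < n \<Longrightarrow> is_mass_function P (V i) (u i)" "\<And>i. i < n \<Longrightarrow> is_mass_function Q (V i) (w i)"
    and Y: "is_mass_function P Y p" "is_mass_function Q Y q"
    and g: "is_cond_mass_function P n V Y g" "is_cond_mass_function Q n V Y g"
    and c: "0 \<le> c" and C: "\<And>v y. (v, y) \<in> C \<Longrightarrow> p y \<le> c * q y"
    and C_sets: "C \<in> sets ((\<Pi>\<^sub>M i\<in>{..<n}. lborel) \<Otimes>\<^sub>M lborel)"
  shows "measure P {\<omega> \<in> space P. ((\<lambda>i\<in>{..<n}. V i \<omega>), Y \<omega>) \<in> C}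
      \<le> c * measure Q {\<omega> \<in> space P. ((\<lambda>i\<in>{..<n}. V i \<omega>), Y \<omega>) \<in> C}"
proof -
  interpret P: prob_space P by fact
  interpret Q: prob_space Q by fact
  define Z where "Z \<omega> = ((\<lambda>i\<in>{..<n}. V i \<omega>), Y \<omega>)" for \<omega>
  have sp: "space Q = space P" using sets by (rule sets_eq_imp_space_eq)
  have V_meas[measurable]: "V i \<in> borel_measurable P" if "i < n" for i
    using V(1)[OF that] by (simp add: is_mass_function_def)
  have Y_meas[measurable]: "Y \<in> borel_measurable P"
    using Y(1) by (simp add: is_mass_function_def)
  have "\<exists>S. countable S \<and> (AE \<omega> in P. V i \<omega> \<in> S) \<and> (AE \<omega> in Q. V i \<omega> \<in> S)" if i: "i < n" for i
  proof -
    obtain S S' where "countable S" "AE \<omega> in P. V i \<omega> \<in> S" "countable S'" "AE \<omega> in Q. V i \<omega> \<in> S'"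
      using V(1)[OF i] V(2)[OF i] unfolding is_mass_function_def by blast
    then show ?thesis by (intro exI[of _ "S \<union> S'"]) (auto elim: eventually_mono)
  qed
  then obtain S where S: "\<And>i. i < n \<Longrightarrow> countable (S i)" "\<And>i. i < n \<Longrightarrow> AE \<omega> in P. V i \<omega> \<in> S i"
      "\<And>i. i < n \<Longrightarrow> AE \<omega> in Q. V i \<omega> \<in> S i"
    by metis
  obtain T where T: "countable T" "AE \<omega> in P. Y \<omega> \<in> T" "AE \<omega> in Q. Y \<omega> \<in> T"
  proof -
    obtain T T' where "countable T" "AE \<omega> in P. Y \<omega> \<in> T" "countable T'" "AE \<omega> in Q. Y \<omega> \<in> T'"
      using Y unfolding is_mass_function_def by blast
    then show ?thesis by (intro that[of "T \<union> T'"]) (auto elim: eventually_mono)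
  qed
  define K where "K = C \<inter> (PiE {..<n} S \<times> T)"
  have K: "countable K"
    unfolding K_def using S(1) T(1) by (intro countable_Int2 countable_SIGMA countable_PiE) auto
  have atom: "{\<omega> \<in> space P. Z \<omega> = z} \<in> sets P" for z
  proof (cases "fst z \<in> extensional {..<n}")
    case True
    then have "{\<omega> \<in> space P. Z \<omega> = z}
        = {\<omega> \<in> space P. (\<forall>i\<in>{..<n}. V i \<omega> = fst z i) \<and> Y \<omega> = snd z}"
      by (auto simp: Z_def prod_eq_iff fun_eq_iff extensional_def restrict_def)
    also have "\<dots> \<in> sets P" by measurable
    finally show ?thesis .
  next
    case False
    then have "{\<omega> \<in> space P. Z \<omega> = z} = {}" by (auto simp: Z_def)
    then show ?thesis by (simp only: sets.empty_sets)
  qed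
  have Z_meas: "Z \<in> measurable P ((\<Pi>\<^sub>M i\<in>{..<n}. lborel) \<Otimes>\<^sub>M lborel)"
    unfolding Z_def by (intro measurable_Pair measurable_restrict) auto
  have event: "{\<omega> \<in> space P. Z \<omega> \<in> C} \<in> sets P"
    using measurable_sets[OF Z_meas C_sets] by (simp add: vimage_def Int_def conj_commute)
  have split_atoms: "emeasure R {\<omega> \<in> space P. Z \<omega> \<in> C}
      = (\<integral>\<^sup>+z. emeasure R {\<omega> \<in> space P. Z \<omega> = z} \<partial>count_space K)"
    if R: "sets R = sets P" "\<And>i. i < n \<Longrightarrow> AE \<omega> in R. V i \<omega> \<in> S i" "AE \<omega> in R. Y \<omega> \<in> T" for R
  proof -
    have spR: "space R = space P" using R(1) by (rule sets_eq_imp_space_eq)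
    have "AE \<omega> in R. \<forall>i\<in>{..<n}. V i \<omega> \<in> S i" using R(2) by (intro AE_finite_allI) auto
    with R(3) have "AE \<omega> in R. Z \<omega> \<in> C \<longleftrightarrow> Z \<omega> \<in> K"
      by eventually_elim (auto simp: Z_def K_def)
    moreover have "{\<omega> \<in> space P. Z \<omega> \<in> K} = (\<Union>z\<in>K. {\<omega> \<in> space P. Z \<omega> = z})" by auto
    moreover have "(\<Union>z\<in>K. {\<omega> \<in> space P. Z \<omega> = z}) \<in> sets P"
      using K atom by (intro sets.countable_UN'') auto
    ultimately have "emeasure R {\<omega> \<in> space P. Z \<omega> \<in> C}
        = emeasure R (\<Union>z\<in>K. {\<omega> \<in> space P. Z \<omega> = z})"
      using event R(1) by (intro emeasure_eq_AE) (auto elim: eventually_mono)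
    also have "\<dots> = (\<integral>\<^sup>+z. emeasure R {\<omega> \<in> space P. Z \<omega> = z} \<partial>count_space K)"
      using K atom R(1) by (intro emeasure_UN_countable) (auto simp: disjoint_family_on_def)
    finally show ?thesis .
  qed
  note atoms_P = split_atoms[of P, OF refl S(2) T(2), simplified]
  note atoms_Q = split_atoms[of Q, OF sets S(3) T(3), simplified]
  \<comment> \<open>Where \<open>r (snd z) = 0\<close> the conditional mass function is arbitrary, but both sides vanish.\<close>
  have joint: "measure R {\<omega> \<in> space P. Z \<omega> = z} = g (fst z) (snd z) * r (snd z)"
    if R: "prob_space R" "sets R = sets P" "is_mass_function R Y r" "is_cond_mass_function R n V Y g"
      and z: "z \<in> K" for R r z
  proof -
    interpret R: prob_space R by fact
    have spR: "space R = space P" using R(2) by (rule sets_eq_imp_space_eq)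
    have r: "r y = measure R {\<omega> \<in> space P. Y \<omega> = y}" for y
      using R(3) by (simp add: is_mass_function_def spR)
    have ext: "fst z \<in> extensional {..<n}" using z by (auto simp: K_def PiE_def)
    have eq: "{\<omega> \<in> space P. Z \<omega> = z} = {\<omega> \<in> space P. (\<forall>i<n. V i \<omega> = fst z i) \<and> Y \<omega> = snd z}"
      using ext by (auto simp: Z_def prod_eq_iff fun_eq_iff extensional_def restrict_def)
    show ?thesis
    proof (cases "r (snd z) = 0")
      case True
      have "measure R {\<omega> \<in> space P. Z \<omega> = z} \<le> measure R {\<omega> \<in> space P. Y \<omega> = snd z}"
        by (intro R.finite_measure_mono) (auto simp: Z_def R(2))
      also have "\<dots> = 0" using True r by simp
      finally have "measure R {\<omega> \<in> space P. Z \<omega> = z} = 0" using measure_nonneg by (intro antisym)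
      then show ?thesis using True by simp
    next
      case False
      then have pos: "0 < r (snd z)" unfolding r using measure_nonneg by (metis less_eq_real_def)
      then have "g (fst z) (snd z) = \<P>(\<omega> in R. (\<forall>i<n. V i \<omega> = fst z i) \<bar> Y \<omega> = snd z)"
        using R(4) by (simp add: is_cond_mass_function_def r spR)
      with pos show ?thesis by (simp add: cond_prob_def spR eq flip: r)
    qed
  qed
  \<comment> \<open>The conditional mass function is sure to be nonnegative only where one of the two laws
    charges \<open>y\<close>; elsewhere both products vanish.\<close>
  have weighted_le: "p y \<le> c * q y \<Longrightarrow> p y * g v y \<le> c * (q y * g v y)" for v y
  proof (cases "p y = 0 \<and> q y = 0")
    case False
    assume le: "p y \<le> c * q y"
    have "0 \<le> g v y"
    proof (cases "p y = 0")
      case True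
      with False have "0 < q y" using mass_function_nonneg[OF Y(2)] by (metis less_eq_real_def)
      then show ?thesis using g(2) Y(2)
        by (simp add: is_cond_mass_function_def is_mass_function_def cond_prob_def)
    next
      case False
      then have "0 < p y" using mass_function_nonneg[OF Y(1)] by (metis less_eq_real_def)
      then show ?thesis using g(1) Y(1)
        by (simp add: is_cond_mass_function_def is_mass_function_def cond_prob_def)
    qed
    then show ?thesis using mult_right_mono[OF le] by (simp add: mult.assoc)
  qed auto
  have "emeasure P {\<omega> \<in> space P. Z \<omega> \<in> C}
      \<le> (\<integral>\<^sup>+z. ennreal c * emeasure Q {\<omega> \<in> space P. Z \<omega> = z} \<partial>count_space K)"
    unfolding atoms_P
  proof (rule nn_integral_mono)
    fix z assume "z \<in> space (count_space K)"
    then have z: "z \<in> K" by simp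
    then have "p (snd z) \<le> c * q (snd z)" using C[of "fst z" "snd z"] by (auto simp: K_def)
    then have "measure P {\<omega> \<in> space P. Z \<omega> = z} \<le> c * measure Q {\<omega> \<in> space P. Z \<omega> = z}"
      using weighted_le[of "snd z" "fst z"]
      by (simp add: joint[OF P refl Y(1) g(1) z] joint[OF Q sets Y(2) g(2) z] mult.commute)
    then show "emeasure P {\<omega> \<in> space P. Z \<omega> = z} \<le> ennreal c * emeasure Q {\<omega> \<in> space P. Z \<omega> = z}"
      by (simp add: P.emeasure_eq_measure Q.emeasure_eq_measure c flip: ennreal_mult)
  qed
  also have "\<dots> = ennreal c * emeasure Q {\<omega> \<in> space P. Z \<omega> \<in> C}"
    by (simp add: nn_integral_cmult atoms_Q)
  finally show ?thesis
    unfolding Z_def by (simp add: P.emeasure_eq_measure Q.emeasure_eq_measure c flip: ennreal_mult)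
qed

text \<open>The continuous counterpart: both joint densities share the factor \<open>g v y\<close>, so the
  inequality between the densities of \<open>Y\<close> passes to the integrands.\<close>

lemma cond_density_function_change_of_measure:
  assumes P: "prob_space P" and Q: "prob_space Q" and space: "space Q = space P"
    and g: "is_cond_density_function P n V Y p g" "is_cond_density_function Q n V Y q g"
    and q: "\<And>y. 0 \<le> q y"
    and c: "0 \<le> c" and C: "\<And>v y. (v, y) \<in> C \<Longrightarrow> p y \<le> c * q y"
    and C_sets: "C \<in> sets ((\<Pi>\<^sub>M i\<in>{..<n}. lborel) \<Otimes>\<^sub>M lborel)"
  shows "measure P {\<omega> \<in> space P. ((\<lambda>i\<in>{..<n}. V i \<omega>), Y \<omega>) \<in> C}
      \<le> c * measure Q {\<omega> \<in> space P. ((\<lambda>i\<in>{..<n}. V i \<omega>), Y \<omega>) \<in> C}"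
proof -
  interpret P: prob_space P by fact
  interpret Q: prob_space Q by fact
  let ?L = "(\<Pi>\<^sub>M i\<in>{..<n}. lborel) \<Otimes>\<^sub>M (lborel :: real measure)"
  let ?Z = "\<lambda>\<omega>. ((\<lambda>i\<in>{..<n}. V i \<omega>), Y \<omega>)"
  have dP: "distributed P ?L ?Z (\<lambda>(v, y). ennreal (g v y * p y))"
    and dQ: "distributed Q ?L ?Z (\<lambda>(v, y). ennreal (g v y * q y))" and g0: "\<And>v y. 0 \<le> g v y"
    using g by (auto simp: is_cond_density_function_def)
  have pre: "{\<omega> \<in> space P. ?Z \<omega> \<in> C} = ?Z -` C \<inter> space P" by auto
  have preQ: "{\<omega> \<in> space P. ?Z \<omega> \<in> C} = ?Z -` C \<inter> space Q" using space by auto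
  have "emeasure P {\<omega> \<in> space P. ?Z \<omega> \<in> C}
      = (\<integral>\<^sup>+z. (case z of (v, y) \<Rightarrow> ennreal (g v y * p y)) * indicator C z \<partial>?L)"
    unfolding pre by (rule distributed_emeasure[OF dP C_sets])
  also have "\<dots> \<le> (\<integral>\<^sup>+z. ennreal c * ((case z of (v, y) \<Rightarrow> ennreal (g v y * q y)) * indicator C z) \<partial>?L)"
  proof (rule nn_integral_mono, clarify)
    fix v y
    show "ennreal (g v y * p y) * indicator C (v, y) \<le> ennreal c * (ennreal (g v y * q y) * indicator C (v, y))"
    proof (cases "(v, y) \<in> C")
      case True
      from mult_left_mono[OF C[OF True] g0[of v y]]
      show ?thesis using True g0[of v y] c q[of y]
        by (simp add: mult_ac flip: ennreal_mult)
    qed simp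
  qed
  also have "\<dots> = ennreal c * (\<integral>\<^sup>+z. (case z of (v, y) \<Rightarrow> ennreal (g v y * q y)) * indicator C z \<partial>?L)"
    using distributed_borel_measurable[OF dQ] C_sets
    by (intro nn_integral_cmult borel_measurable_times_ennreal) auto
  also have "\<dots> = ennreal c * emeasure Q {\<omega> \<in> space P. ?Z \<omega> \<in> C}"
    unfolding preQ by (simp add: distributed_emeasure[OF dQ C_sets])
  finally show ?thesis
    by (simp add: P.emeasure_eq_measure Q.emeasure_eq_measure c flip: ennreal_mult)
qed


section \<open>A maximal inequality for the likelihood ratio\<close>

lemma right_continuous_less_eventually:
  fixes a b :: "real \<Rightarrow> real"
  assumes "right_continuous a" "right_continuous b" "0 \<le> t" "a t < b t"
  shows "\<forall>\<^sub>F u in at_right t. a u < b u"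
proof -
  have "(a \<longlongrightarrow> a t) (at_right t)" "(b \<longlongrightarrow> b t) (at_right t)"
    using assms(1-3) by (auto simp: right_continuous_def continuous_within)
  then have "((\<lambda>u. b u - a u) \<longlongrightarrow> b t - a t) (at_right t)" by (intro tendsto_diff)
  then have "\<forall>\<^sub>F u in at_right t. 0 < b u - a u" using assms(4) by (intro order_tendstoD) auto
  then show ?thesis by (rule eventually_mono) simp
qed

text \<open>Uncountably many times are replaced by rational ones through this lemma: a condition that
  persists to the right of \<open>t\<close> holds at a rational time just after \<open>t\<close>.\<close>

lemma right_open_hits_rational:
  fixes t q :: real
  assumes "\<forall>\<^sub>F u in at_right t. P u" "t < q"
  shows "\<exists>r\<in>\<rat>. t < r \<and> r < q \<and> P r"
proof -
  obtain b where b: "b > t" "\<And>u. t < u \<Longrightarrow> u < b \<Longrightarrow> P u"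
    using assms(1) by (auto simp: eventually_at_right_field)
  obtain r where "r \<in> \<rat>" "t < r" "r < min b q"
    using Rats_dense_in_real[of t "min b q"] b(1) assms(2) by auto
  then show ?thesis using b(2) by auto
qed

lemma grid_nonneg:
  fixes s :: "nat \<Rightarrow> real"
  assumes "s 0 = 0" "\<And>i. i < n \<Longrightarrow> s i < s (Suc i)" "k \<le> n"
  shows "0 \<le> s k"
  using assms(3)
proof (induction k)
  case (Suc k)
  then show ?case using assms(2)[of k] by simp
qed (simp add: assms(1))

locale likelihood_process =
  fixes \<Theta> :: "real set"
    and N :: "'a measure"
    and M :: "real \<Rightarrow> 'a measure"
    and X :: "real \<Rightarrow> 'a \<Rightarrow> real"
    and f :: "real \<Rightarrow> real \<Rightarrow> real \<Rightarrow> real"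
    and kind :: law_kind
  assumes prob: "\<And>\<theta>. \<theta> \<in> \<Theta> \<Longrightarrow> prob_space (M \<theta>)"
    and events: "\<And>\<theta>. \<theta> \<in> \<Theta> \<Longrightarrow> sets (M \<theta>) = sets N"
    and lik: "\<And>\<theta> t. \<theta> \<in> \<Theta> \<Longrightarrow> t \<ge> 0 \<Longrightarrow> is_mass_or_density kind (M \<theta>) (X t) (\<lambda>x. f t x \<theta>)"
    and lik_path_right_cont:
      "\<And>\<theta> \<omega>. \<theta> \<in> \<Theta> \<Longrightarrow> \<omega> \<in> space N \<Longrightarrow> right_continuous (\<lambda>t. f t (X t \<omega>) \<theta>)"
    and sufficient: "past_given_present_free_of_parameter kind \<Theta> M X f"
begin

lemma space_M: "\<theta> \<in> \<Theta> \<Longrightarrow> space (M \<theta>) = space N"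
  by (rule sets_eq_imp_space_eq[OF events])

lemma likelihood_nonneg:
  assumes "\<theta> \<in> \<Theta>" "0 \<le> t"
  shows "0 \<le> f t x \<theta>"
proof (cases kind)
  case Discrete
  then show ?thesis using lik[OF assms] mass_function_nonneg by simp
next
  case Continuous
  then show ?thesis using lik[OF assms] by (simp add: is_density_function_def)
qed

lemma likelihood_measurable:
  assumes "\<theta> \<in> \<Theta>" "0 \<le> t"
  shows "(\<lambda>x. f t x \<theta>) \<in> borel_measurable borel"
proof (cases kind)
  case Discrete
  then show ?thesis using lik[OF assms] by (intro mass_function_measurable) simp
next
  case Continuous
  then show ?thesis using lik[OF assms] by (intro density_function_measurable) simp
qed

lemma process_measurable:
  assumes "\<theta> \<in> \<Theta>" "0 \<le> t"
  shows "X t \<in> borel_measurable N"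
proof -
  have "X t \<in> borel_measurable (M \<theta>)"
  proof (cases kind)
    case Discrete
    then show ?thesis using lik[OF assms] by (simp add: is_mass_function_def)
  next
    case Continuous
    then show ?thesis using lik[OF assms] by (simp add: is_density_function_def distributed_def)
  qed
  then show ?thesis using measurable_cong_sets[OF events[OF assms(1)] refl] by metis
qed

lemma path_likelihood_measurable:
  assumes "\<theta> \<in> \<Theta>" "0 \<le> t"
  shows "(\<lambda>\<omega>. f t (X t \<omega>) \<theta>) \<in> borel_measurable N"
  by (rule measurable_compose[OF process_measurable[OF assms] likelihood_measurable[OF assms]])

text \<open>The event \<open>C\<close> may depend on the past as well as on the present, whereas the comparison of
  the two likelihoods concerns the present only.\<close>

lemma past_change_of_measure:
  assumes par: "\<theta> \<in> \<Theta>" "\<eta> \<in> \<Theta>" and n: "1 \<le> n" and s0: "s 0 = 0"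
    and s_less: "\<And>i. i < n \<Longrightarrow> s i < s (Suc i)" and c: "0 \<le> c"
    and C: "\<And>v y. (v, y) \<in> C \<Longrightarrow> f (s n) y \<theta> \<le> c * f (s n) y \<eta>"
    and C_sets: "C \<in> sets ((\<Pi>\<^sub>M i\<in>{..<n}. lborel) \<Otimes>\<^sub>M lborel)"
  shows "measure (M \<theta>) {\<omega> \<in> space N. ((\<lambda>i\<in>{..<n}. X (s i) \<omega>), X (s n) \<omega>) \<in> C}
      \<le> c * measure (M \<eta>) {\<omega> \<in> space N. ((\<lambda>i\<in>{..<n}. X (s i) \<omega>), X (s n) \<omega>) \<in> C}"
proof -
  have s_nonneg: "0 \<le> s k" if "k \<le> n" for k
    using grid_nonneg[of s n k] s0 s_less that by blast
  obtain g where g: "\<And>\<theta>. \<theta> \<in> \<Theta> \<Longrightarrow>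
      is_cond_mass_or_density kind (M \<theta>) n (\<lambda>i. X (s i)) (X (s n)) (\<lambda>x. f (s n) x \<theta>) g"
    using sufficient n s0 s_less unfolding past_given_present_free_of_parameter_def by blast
  have sets_eq: "sets (M \<eta>) = sets (M \<theta>)" using events par by simp
  show ?thesis
  proof (cases kind)
    case Discrete
    have V: "is_mass_function (M \<xi>) (X (s i)) (\<lambda>x. f (s i) x \<xi>)" if "\<xi> \<in> \<Theta>" "i \<le> n" for \<xi> i
      using lik[OF that(1) s_nonneg[OF that(2)]] Discrete by simp
    have g': "is_cond_mass_function (M \<xi>) n (\<lambda>i. X (s i)) (X (s n)) g" if "\<xi> \<in> \<Theta>" for \<xi>
      using g[OF that] Discrete by simp
    have "measure (M \<theta>) {\<omega> \<in> space (M \<theta>). ((\<lambda>i\<in>{..<n}. X (s i) \<omega>), X (s n) \<omega>) \<in> C}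
      \<le> c * measure (M \<eta>) {\<omega> \<in> space (M \<theta>). ((\<lambda>i\<in>{..<n}. X (s i) \<omega>), X (s n) \<omega>) \<in> C}"
      by (rule cond_mass_function_change_of_measure[OF prob[OF par(1)] prob[OF par(2)] sets_eq
          V[OF par(1) less_imp_le] V[OF par(2) less_imp_le] V[OF par(1) order_refl]
          V[OF par(2) order_refl] g'[OF par(1)] g'[OF par(2)] c C C_sets])
    then show ?thesis by (simp only: space_M[OF par(1)])
  next
    case Continuous
    have g': "is_cond_density_function (M \<xi>) n (\<lambda>i. X (s i)) (X (s n)) (\<lambda>x. f (s n) x \<xi>) g"
      if "\<xi> \<in> \<Theta>" for \<xi>
      using g[OF that] Continuous by simp
    have "measure (M \<theta>) {\<omega> \<in> space (M \<theta>). ((\<lambda>i\<in>{..<n}. X (s i) \<omega>), X (s n) \<omega>) \<in> C}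
      \<le> c * measure (M \<eta>) {\<omega> \<in> space (M \<theta>). ((\<lambda>i\<in>{..<n}. X (s i) \<omega>), X (s n) \<omega>) \<in> C}"
      by (rule cond_density_function_change_of_measure[OF prob[OF par(1)] prob[OF par(2)]
          sets_eq_imp_space_eq[OF sets_eq] g'[OF par(1)] g'[OF par(2)]
          likelihood_nonneg[OF par(2) s_nonneg[OF order_refl]] c C C_sets])
    then show ?thesis by (simp only: space_M[OF par(1)])
  qed
qed

lemma beaten_event_measurable:
  assumes "\<theta> \<in> \<Theta>" "\<eta> \<in> \<Theta>" "0 \<le> t"
  shows "{\<omega> \<in> space N. f t (X t \<omega>) \<theta> < c * f t (X t \<omega>) \<eta>} \<in> sets N"
  using path_likelihood_measurable[OF assms(1,3)] path_likelihood_measurable[OF assms(2,3)]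
  by measurable

text \<open>The events \<open>E k\<close> that \<open>\<theta>\<close> is beaten by \<open>\<eta>\<close> for the first time at \<open>s k\<close>
  are disjoint, and each is at most \<open>c\<close> times as likely under \<open>\<theta>\<close> as under \<open>\<eta>\<close>. The
  sum is at most \<open>c\<close> because the probabilities under \<open>\<eta>\<close> add up to at most \<open>1\<close>.
  The index starts at \<open>1\<close>: time \<open>0\<close> only anchors the grid, since being beaten at time
  \<open>0\<close> implies being beaten shortly afterwards.\<close>

lemma maximal_inequality_grid:
  assumes par: "\<theta> \<in> \<Theta>" "\<eta> \<in> \<Theta>" and s0: "s 0 = 0"
    and s_less: "\<And>i. i < n \<Longrightarrow> s i < s (Suc i)" and c: "0 \<le> c"
  shows "measure (M \<theta>) {\<omega> \<in> space N. \<exists>k\<in>{1..n}. f (s k) (X (s k) \<omega>) \<theta> < c * f (s k) (X (s k) \<omega>) \<eta>} \<le> c"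
proof -
  interpret P: prob_space "M \<theta>" by (rule prob[OF par(1)])
  interpret Q: prob_space "M \<eta>" by (rule prob[OF par(2)])
  define D where "D t = {x. f t x \<theta> < c * f t x \<eta>}" for t
  define E where "E k = {\<omega> \<in> space N. X (s k) \<omega> \<in> D (s k) \<and> (\<forall>l\<in>{1..<k}. X (s l) \<omega> \<notin> D (s l))}" for k
  have s_nonneg: "0 \<le> s k" if "k \<le> n" for k
    using grid_nonneg[of s n k] s0 s_less that by blast
  have D_sets: "D (s k) \<in> sets borel" if "k \<le> n" for k
  proof -
    have [measurable]: "(\<lambda>x. f (s k) x \<theta>) \<in> borel_measurable borel" "(\<lambda>x. f (s k) x \<eta>) \<in> borel_measurable borel"
      using likelihood_measurable par s_nonneg[OF that] by auto
    show ?thesis unfolding D_def by measurable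
  qed
  have E_bound: "measure (M \<theta>) (E k) \<le> c * measure (M \<eta>) (E k)" and E_sets: "E k \<in> sets N"
    if k: "k \<in> {1..n}" for k
  proof -
    let ?L = "(\<Pi>\<^sub>M i\<in>{..<k}. lborel) \<Otimes>\<^sub>M (lborel :: real measure)"
    define C where "C = {z \<in> space ?L. snd z \<in> D (s k) \<and> (\<forall>l\<in>{1..<k}. fst z l \<notin> D (s l))}"
    have [measurable]: "D (s k) \<in> sets borel" "\<And>l. l \<in> {1..<k} \<Longrightarrow> D (s l) \<in> sets borel"
      using D_sets k by auto
    have [measurable]: "(\<lambda>z. fst z l) \<in> borel_measurable ?L" if "l \<in> {1..<k}" for l
      using that by (intro measurable_compose[OF measurable_fst]) auto
    have C_sets: "C \<in> sets ?L" unfolding C_def by measurable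
    have E_C: "E k = {\<omega> \<in> space N. ((\<lambda>i\<in>{..<k}. X (s i) \<omega>), X (s k) \<omega>) \<in> C}"
      by (auto simp: E_def C_def space_pair_measure space_PiM)
    show "measure (M \<theta>) (E k) \<le> c * measure (M \<eta>) (E k)"
      unfolding E_C
    proof (rule past_change_of_measure[where s = s, OF par])
      show "f (s k) y \<theta> \<le> c * f (s k) y \<eta>" if "(v, y) \<in> C" for v y
        using that by (simp add: C_def D_def)
    qed (use k s0 s_less c C_sets in auto)
    have [measurable]: "X (s k) \<in> borel_measurable N" "\<And>l. l \<in> {1..<k} \<Longrightarrow> X (s l) \<in> borel_measurable N"
      using process_measurable[OF par(1)] s_nonneg k by auto
    show "E k \<in> sets N" unfolding E_def by measurable
  qed
  have disj: "disjoint_family_on E {1..n}"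
    unfolding disjoint_family_on_def
  proof (intro ballI impI)
    fix k l assume "k \<in> {1..n}" "l \<in> {1..n}" "k \<noteq> l"
    then show "E k \<inter> E l = {}" by (cases "k < l") (auto simp: E_def)
  qed
  have first: "{\<omega> \<in> space N. \<exists>k\<in>{1..n}. f (s k) (X (s k) \<omega>) \<theta> < c * f (s k) (X (s k) \<omega>) \<eta>} = (\<Union>k\<in>{1..n}. E k)"
  proof (intro equalityI subsetI)
    fix \<omega> assume "\<omega> \<in> {\<omega> \<in> space N. \<exists>k\<in>{1..n}. f (s k) (X (s k) \<omega>) \<theta> < c * f (s k) (X (s k) \<omega>) \<eta>}"
    then obtain k where \<omega>: "\<omega> \<in> space N" and k: "k \<in> {1..n} \<and> X (s k) \<omega> \<in> D (s k)" by (auto simp: D_def)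
    define j where "j = (LEAST k. k \<in> {1..n} \<and> X (s k) \<omega> \<in> D (s k))"
    have j: "j \<in> {1..n} \<and> X (s j) \<omega> \<in> D (s j)" unfolding j_def by (rule LeastI[where P = "\<lambda>k. k \<in> {1..n} \<and> X (s k) \<omega> \<in> D (s k)", OF k])
    moreover have "X (s l) \<omega> \<notin> D (s l)" if "l \<in> {1..<j}" for l
      using not_less_Least[of l "\<lambda>k. k \<in> {1..n} \<and> X (s k) \<omega> \<in> D (s k)", folded j_def] that j by auto
    ultimately show "\<omega> \<in> (\<Union>k\<in>{1..n}. E k)" using \<omega> by (auto simp: E_def)
  qed (auto simp: E_def D_def)
  have "measure (M \<theta>) (\<Union>k\<in>{1..n}. E k) = (\<Sum>k\<in>{1..n}. measure (M \<theta>) (E k))"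
    using E_sets disj by (intro P.finite_measure_finite_Union) (auto simp: events par)
  also have "\<dots> \<le> (\<Sum>k\<in>{1..n}. c * measure (M \<eta>) (E k))" by (intro sum_mono E_bound)
  also have "\<dots> = c * measure (M \<eta>) (\<Union>k\<in>{1..n}. E k)"
    using E_sets disj by (subst Q.finite_measure_finite_Union) (auto simp: events par sum_distrib_left)
  also have "\<dots> \<le> c" using c by (simp add: mult_left_le)
  finally show ?thesis unfolding first .
qed

lemma maximal_inequality_finite:
  assumes par: "\<theta> \<in> \<Theta>" "\<eta> \<in> \<Theta>" and c: "0 \<le> c" and F: "finite F" "\<And>t. t \<in> F \<Longrightarrow> 0 < t"
  shows "measure (M \<theta>) {\<omega> \<in> space N. \<exists>t\<in>F. f t (X t \<omega>) \<theta> < c * f t (X t \<omega>) \<eta>} \<le> c"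
proof -
  \<comment> \<open>The grid is \<open>0\<close> followed by the elements of \<open>F\<close> in increasing order.\<close>
  let ?xs = "sorted_list_of_set F"
  define s where "s k = (case k of 0 \<Rightarrow> 0 | Suc i \<Rightarrow> ?xs ! i)" for k
  have s_less: "s i < s (Suc i)" if "i < length ?xs" for i
  proof (cases i)
    case 0
    have "?xs ! 0 \<in> F" using that 0 F(1) nth_mem set_sorted_list_of_set by metis
    then show ?thesis using F(2) 0 by (simp add: s_def)
  next
    case (Suc j)
    then show ?thesis using that sorted_wrt_nth_less[OF strict_sorted_list_of_set, of j i F]
      by (simp add: s_def)
  qed
  have range: "F = s ` {1..length ?xs}"
  proof -
    have "F = (\<lambda>i. ?xs ! i) ` {0..<length ?xs}" 
      by (subst set_sorted_list_of_set[OF F(1), symmetric], subst set_conv_nth) auto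
    also have "\<dots> = (\<lambda>i. s (Suc i)) ` {0..<length ?xs}" by (simp add: s_def)
    also have "\<dots> = s ` Suc ` {0..<length ?xs}" by (simp only: image_image)
    also have "Suc ` {0..<length ?xs} = {1..length ?xs}" by (simp add: image_Suc_atLeastLessThan atLeastLessThanSuc_atLeastAtMost)
    finally show ?thesis .
  qed
  have "measure (M \<theta>) {\<omega> \<in> space N. \<exists>k\<in>{1..length ?xs}. f (s k) (X (s k) \<omega>) \<theta> < c * f (s k) (X (s k) \<omega>) \<eta>} \<le> c"
    using s_less c by (intro maximal_inequality_grid[where s = s, OF par]) (simp_all add: s_def)
  moreover have "(\<exists>t\<in>F. R t) \<longleftrightarrow> (\<exists>k\<in>{1..length ?xs}. R (s k))" for R by (subst range) blast
  ultimately show ?thesis by simp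
qed

lemma ever_beaten_rational:
  assumes par: "\<theta> \<in> \<Theta>" "\<eta> \<in> \<Theta>" and \<omega>: "\<omega> \<in> space N" and t: "0 \<le> t"
    and less: "f t (X t \<omega>) \<theta> < c * f t (X t \<omega>) \<eta>"
  shows "\<exists>r\<in>\<rat> \<inter> {0<..}. f r (X r \<omega>) \<theta> < c * f r (X r \<omega>) \<eta>"
proof -
  have "right_continuous (\<lambda>t. c * f t (X t \<omega>) \<eta>)"
    using lik_path_right_cont[OF par(2) \<omega>] by (auto simp: right_continuous_def intro!: continuous_intros)
  from right_continuous_less_eventually[OF lik_path_right_cont[OF par(1) \<omega>] this t less]
  show ?thesis using right_open_hits_rational[of _ t "t + 1"] t by force
qed

text \<open>The event is written without division: \<open>f \<theta> < c * f \<eta>\<close> says that the likelihood ratio of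
  \<open>\<eta>\<close> to \<open>\<theta>\<close> exceeds \<open>1 / c\<close>, and it makes sense where likelihoods vanish. It is the
  increasing union of the events for the finitely many first positive rationals of an enumeration.\<close>

lemma maximal_inequality:
  assumes par: "\<theta> \<in> \<Theta>" "\<eta> \<in> \<Theta>" and c: "0 \<le> c"
  shows "{\<omega> \<in> space N. \<exists>t\<ge>0. f t (X t \<omega>) \<theta> < c * f t (X t \<omega>) \<eta>} \<in> sets N"
    and "measure (M \<theta>) {\<omega> \<in> space N. \<exists>t\<ge>0. f t (X t \<omega>) \<theta> < c * f t (X t \<omega>) \<eta>} \<le> c"
proof -
  interpret P: prob_space "M \<theta>" by (rule prob[OF par(1)])
  let ?B = "\<lambda>t \<omega>. f t (X t \<omega>) \<theta> < c * f t (X t \<omega>) \<eta>"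
  let ?R = "\<rat> \<inter> {0<..} :: real set"
  have R: "countable ?R" "?R \<noteq> {}" using countable_rat by (auto intro: exI[of _ 1])
  define e where "e = from_nat_into ?R"
  have e_range: "range e = ?R" unfolding e_def using R(2,1) by (rule range_from_nat_into)
  define A where "A n = {\<omega> \<in> space N. \<exists>t\<in>e ` {..n}. ?B t \<omega>}" for n
  have e_pos: "0 < e i" for i using e_range by blast
  have A_sets: "A n \<in> sets N" for n
  proof -
    have "A n = (\<Union>i\<in>{..n}. {\<omega> \<in> space N. ?B (e i) \<omega>})" by (auto simp: A_def)
    also have "\<dots> \<in> sets N"
      using beaten_event_measurable[OF par] e_pos by (intro sets.finite_UN) (auto intro: less_imp_le)
    finally show ?thesis .
  qed
  have union: "{\<omega> \<in> space N. \<exists>t\<ge>0. ?B t \<omega>} = (\<Union>n. A n)"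
  proof (intro equalityI subsetI)
    fix \<omega> assume "\<omega> \<in> {\<omega> \<in> space N. \<exists>t\<ge>0. ?B t \<omega>}"
    then obtain r where "\<omega> \<in> space N" "r \<in> ?R" "?B r \<omega>" using ever_beaten_rational[OF par] by blast
    moreover from this obtain n where "r = e n" using e_range by blast
    ultimately show "\<omega> \<in> (\<Union>n. A n)" by (auto simp: A_def)
  next
    fix \<omega> assume "\<omega> \<in> (\<Union>n. A n)"
    then show "\<omega> \<in> {\<omega> \<in> space N. \<exists>t\<ge>0. ?B t \<omega>}" using e_pos by (auto simp: A_def intro: less_imp_le)
  qed
  show "{\<omega> \<in> space N. \<exists>t\<ge>0. ?B t \<omega>} \<in> sets N" unfolding union using A_sets by blast
  have "(\<lambda>n. measure (M \<theta>) (A n)) \<longlonglongrightarrow> measure (M \<theta>) (\<Union>n. A n)"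
    using A_sets by (intro P.finite_Lim_measure_incseq) (force simp: events par incseq_def A_def)+
  moreover have "measure (M \<theta>) (A n) \<le> c" for n
    unfolding A_def using e_pos by (intro maximal_inequality_finite[OF par c]) auto
  ultimately show "measure (M \<theta>) {\<omega> \<in> space N. \<exists>t\<ge>0. ?B t \<omega>} \<le> c"
    unfolding union by (intro LIMSEQ_le_const2) auto
qed

end

section \<open>The stopping rule\<close>

text \<open>Since \<open>a < 1\<close> and \<open>b < 1\<close>, the conventions for a zero denominator agree with the
  inequalities without division: the ratio \<open>1\<close> given to \<open>0 / 0\<close> satisfies neither
  condition, as \<open>0 < 0\<close> is false, and \<open>\<infinity>\<close> satisfies only the first.\<close>

lemma lik_ratio_gt_iff:
  assumes "0 \<le> f t x \<theta>'" "0 \<le> f t x \<theta>''" "0 < a" "a < 1"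
  shows "lik_ratio f t x \<theta>' \<theta>'' > ereal (1 / a) \<longleftrightarrow> f t x \<theta>' < a * f t x \<theta>''"
proof (cases "f t x \<theta>' = 0")
  case True
  then show ?thesis using assms
    by (cases "f t x \<theta>'' = 0") (simp_all add: lik_ratio_def one_ereal_def)
next
  case False
  then have "0 < f t x \<theta>'" using assms by simp
  then show ?thesis using assms by (simp add: lik_ratio_def field_simps)
qed

lemma lik_ratio_less_iff:
  assumes "0 \<le> f t x \<theta>'" "0 \<le> f t x \<theta>''" "0 < b" "b < 1"
  shows "lik_ratio f t x \<theta>' \<theta>'' < ereal b \<longleftrightarrow> f t x \<theta>'' < b * f t x \<theta>'"
proof (cases "f t x \<theta>' = 0")
  case True
  then show ?thesis using assms
    by (cases "f t x \<theta>'' = 0") (simp_all add: lik_ratio_def one_ereal_def)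
next
  case False
  then have "0 < f t x \<theta>'" using assms by simp
  then show ?thesis using assms by (simp add: lik_ratio_def field_simps)
qed

text \<open>A descent from \<open>a\<close> to \<open>b\<close> puts the mode strictly to the left of \<open>b\<close>.\<close>

lemma unimodal_no_ascent_after_descent:
  assumes "unimodal_on \<Theta> g" and "a \<in> \<Theta>" "b \<in> \<Theta>" "c \<in> \<Theta>" "d \<in> \<Theta>" and "a \<le> b" "b \<le> c" "c \<le> d"
    and descent: "g b < g a"
  shows "g d \<le> g c"
proof -
  obtain z where up: "mono_on {\<theta> \<in> \<Theta>. \<theta> \<le> z} g" and down: "antimono_on {\<theta> \<in> \<Theta>. z \<le> \<theta>} g"
    using assms(1) by (auto simp: unimodal_on_def)
  have "z < b"
  proof (rule ccontr)
    assume "\<not> z < b"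
    then have "g a \<le> g b" using assms by (intro mono_onD[OF up]) auto
    with descent show False by simp
  qed
  then show ?thesis using assms by (intro monotone_onD[OF down]) auto
qed

locale csprt = likelihood_process \<Theta> N M X f kind
  for \<Theta> :: "real set"
    and N :: "'a measure"
    and M :: "real \<Rightarrow> 'a measure"
    and X :: "real \<Rightarrow> 'a \<Rightarrow> real"
    and f :: "real \<Rightarrow> real \<Rightarrow> real \<Rightarrow> real"
    and kind :: law_kind +
  fixes m :: nat and \<theta> \<alpha> \<beta> :: "nat \<Rightarrow> real"
  assumes hyps_in: "\<And>i. i < m \<Longrightarrow> \<theta> i \<in> \<Theta>"
    and \<alpha>: "\<And>i. 1 \<le> i \<Longrightarrow> i < m \<Longrightarrow> \<alpha> i \<in> {0<..<1}"
    and \<beta>: "\<And>i. 1 \<le> i \<Longrightarrow> i < m \<Longrightarrow> \<beta> i \<in> {0<..<1}"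
begin

abbreviation stops :: "nat \<Rightarrow> real \<Rightarrow> 'a \<Rightarrow> bool" where
  "stops j t \<omega> \<equiv> stop_cond m \<theta> \<alpha> \<beta> f X j t \<omega>"

abbreviation hyp_lik :: "nat \<Rightarrow> real \<Rightarrow> 'a \<Rightarrow> real" where
  "hyp_lik i t \<omega> \<equiv> f t (X t \<omega>) (\<theta> i)"

lemma ratio_gt_iff:
  assumes "1 \<le> i" "i < m" "0 \<le> t"
  shows "lik_ratio f t (X t \<omega>) (\<theta> (i - 1)) (\<theta> i) > ereal (1 / \<alpha> i)
    \<longleftrightarrow> hyp_lik (i - 1) t \<omega> < \<alpha> i * hyp_lik i t \<omega>"
  using assms \<alpha>[of i] by (intro lik_ratio_gt_iff likelihood_nonneg hyps_in) auto

lemma ratio_less_iff: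
  assumes "1 \<le> i" "i < m" "0 \<le> t"
  shows "lik_ratio f t (X t \<omega>) (\<theta> (i - 1)) (\<theta> i) < ereal (\<beta> i)
    \<longleftrightarrow> hyp_lik i t \<omega> < \<beta> i * hyp_lik (i - 1) t \<omega>"
  using assms \<beta>[of i] by (intro lik_ratio_less_iff likelihood_nonneg hyps_in) auto

lemma stops_iff:
  assumes "j < m" "0 \<le> t"
  shows "stops j t \<omega> \<longleftrightarrow>
      (\<forall>i\<in>{1..j}. hyp_lik (i - 1) t \<omega> < \<alpha> i * hyp_lik i t \<omega>) \<and>
      (\<forall>i\<in>{j<..<m}. hyp_lik i t \<omega> < \<beta> i * hyp_lik (i - 1) t \<omega>)"
proof -
  have "lik_ratio f t (X t \<omega>) (\<theta> (i - 1)) (\<theta> i) > ereal (1 / \<alpha> i)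
      \<longleftrightarrow> hyp_lik (i - 1) t \<omega> < \<alpha> i * hyp_lik i t \<omega>" if "0 < i \<and> i \<le> j" for i
    using assms that by (intro ratio_gt_iff) auto
  moreover have "lik_ratio f t (X t \<omega>) (\<theta> (i - 1)) (\<theta> i) < ereal (\<beta> i)
      \<longleftrightarrow> hyp_lik i t \<omega> < \<beta> i * hyp_lik (i - 1) t \<omega>" if "j < i \<and> i < m" for i
    using assms that by (intro ratio_less_iff) auto
  ultimately show ?thesis by (auto simp: stop_cond_def)
qed

lemma hyp_lik_right_continuous:
  assumes "i < m" "\<omega> \<in> space N"
  shows "right_continuous (\<lambda>t. a * hyp_lik i t \<omega>)"
  using lik_path_right_cont[OF hyps_in[OF assms(1)] assms(2)]
  by (auto simp: right_continuous_def intro!: continuous_intros)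

lemma stops_measurable:
  assumes "j < m" "0 \<le> t"
  shows "{\<omega> \<in> space N. stops j t \<omega>} \<in> sets N"
proof -
  have [measurable]: "hyp_lik i t \<in> borel_measurable N" if "i < m" for i
    using path_likelihood_measurable[OF hyps_in[OF that] assms(2)] .
  have "{\<omega> \<in> space N. \<forall>i\<in>{1..j}. hyp_lik (i - 1) t \<omega> < \<alpha> i * hyp_lik i t \<omega>} \<in> sets N"
    using assms(1) by (intro sets.sets_Collect_finite_All borel_measurable_less) auto
  moreover have "{\<omega> \<in> space N. \<forall>i\<in>{j<..<m}. hyp_lik i t \<omega> < \<beta> i * hyp_lik (i - 1) t \<omega>} \<in> sets N"
    by (intro sets.sets_Collect_finite_All borel_measurable_less) auto
  ultimately show ?thesis unfolding stops_iff[OF assms] by (rule sets.sets_Collect_conj[rotated])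
qed

text \<open>All inequalities of the stopping condition are strict and their sides right-continuous in
  time.\<close>

lemma stops_right_open:
  assumes \<omega>: "\<omega> \<in> space N" and j: "j < m" and t: "0 \<le> t" and stop: "stops j t \<omega>"
  shows "\<forall>\<^sub>F u in at_right t. stops j u \<omega>"
proof -
  have "\<forall>\<^sub>F u in at_right t. \<forall>i\<in>{1..j}. 1 * hyp_lik (i - 1) u \<omega> < \<alpha> i * hyp_lik i u \<omega>"
    using stop j \<omega> t
    by (intro eventually_ball_finite ballI right_continuous_less_eventually hyp_lik_right_continuous)
      (auto simp: stops_iff)
  moreover have "\<forall>\<^sub>F u in at_right t. \<forall>i\<in>{j<..<m}. 1 * hyp_lik i u \<omega> < \<beta> i * hyp_lik (i - 1) u \<omega>"
    using stop j \<omega> t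
    by (intro eventually_ball_finite ballI right_continuous_less_eventually hyp_lik_right_continuous)
      (auto simp: stops_iff)
  moreover have "\<forall>\<^sub>F u in at_right t. t < u" by (rule eventually_at_right_less)
  ultimately show ?thesis by eventually_elim (use t j in \<open>simp add: stops_iff\<close>)
qed

lemma stops_before_iff_rational:
  assumes "\<omega> \<in> space N" "j < m"
  shows "(\<exists>t. 0 \<le> t \<and> t < q \<and> stops j t \<omega>) \<longleftrightarrow> (\<exists>r\<in>\<rat> \<inter> {0..<q}. stops j r \<omega>)"
proof
  assume "\<exists>t. 0 \<le> t \<and> t < q \<and> stops j t \<omega>"
  then obtain t where t: "0 \<le> t" "t < q" "stops j t \<omega>" by blast
  from right_open_hits_rational[OF stops_right_open[OF assms t(1,3)] t(2)] t(1)
  show "\<exists>r\<in>\<rat> \<inter> {0..<q}. stops j r \<omega>" by force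
qed auto

text \<open>The right-hand side speaks of rational times and does not mention the infimum, which makes
  acceptance measurable. The infimum lies below \<open>q\<close> exactly if some stopping condition is met
  before \<open>q\<close>, so acceptance of \<open>j\<close> means that \<open>j\<close>'s condition is met before every rational
  \<open>q\<close> before which some condition is met.\<close>

lemma accepts_iff:
  assumes \<omega>: "\<omega> \<in> space N" and j: "j < m"
  shows "accepts m \<theta> \<alpha> \<beta> f X j \<omega> \<longleftrightarrow>
      (\<exists>q\<in>\<rat>. \<exists>k<m. \<exists>r\<in>\<rat> \<inter> {0..<q}. stops k r \<omega>) \<and>
      (\<forall>q\<in>\<rat>. (\<exists>k<m. \<exists>r\<in>\<rat> \<inter> {0..<q}. stops k r \<omega>) \<longrightarrow> (\<exists>r\<in>\<rat> \<inter> {0..<q}. stops j r \<omega>))"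
    (is "_ \<longleftrightarrow> ?T \<and> ?A")
proof -
  let ?S = "{t. 0 \<le> t \<and> (\<exists>k<m. stops k t \<omega>)}"
  let ?\<tau> = "stop_time m \<theta> \<alpha> \<beta> f X \<omega>"
  have \<tau>: "?\<tau> = Inf ?S" by (simp add: stop_time_def)
  have bdd: "bdd_below ?S" by (rule bdd_belowI[of _ 0]) simp
  have before: "(\<exists>k<m. \<exists>r\<in>\<rat> \<inter> {0..<q}. stops k r \<omega>) \<longleftrightarrow> (\<exists>t\<in>?S. t < q)" for q
    using stops_before_iff_rational[OF \<omega>, of _ q] by blast
  have T: "?T \<longleftrightarrow> terminates m \<theta> \<alpha> \<beta> f X \<omega>"
  proof -
    have "?T \<longleftrightarrow> (\<exists>q\<in>\<rat>. \<exists>t\<in>?S. t < q)" unfolding before ..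
    also have "\<dots> \<longleftrightarrow> ?S \<noteq> {}"
    proof
      assume "?S \<noteq> {}"
      then obtain t where "t \<in> ?S" by blast
      moreover obtain q where "q \<in> \<rat>" "t < q" using Rats_dense_in_real[of t "t + 1"] by auto
      ultimately show "\<exists>q\<in>\<rat>. \<exists>t\<in>?S. t < q" by blast
    qed blast
    finally show ?thesis by (auto simp: terminates_def)
  qed
  have "?A \<longleftrightarrow> (\<forall>\<epsilon>>0. \<exists>t. ?\<tau> \<le> t \<and> t < ?\<tau> + \<epsilon> \<and> stops j t \<omega>)" (is "_ \<longleftrightarrow> ?A'")
    if ne: "?S \<noteq> {}"
  proof
    assume A: ?A
    show ?A'
    proof (intro allI impI)
      fix \<epsilon> :: real assume "0 < \<epsilon>"
      then obtain t where t: "t \<in> ?S" "t < ?\<tau> + \<epsilon>" using cInf_lessD[OF ne, of "?\<tau> + \<epsilon>"] \<tau> by auto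
      obtain q where q: "q \<in> \<rat>" "t < q" "q < ?\<tau> + \<epsilon>" using Rats_dense_in_real[OF t(2)] by blast
      then obtain r where r: "0 \<le> r" "r < q" "stops j r \<omega>" using A before t(1) by fastforce
      then have "?\<tau> \<le> r" unfolding \<tau> using j by (intro cInf_lower bdd) auto
      then show "\<exists>t. ?\<tau> \<le> t \<and> t < ?\<tau> + \<epsilon> \<and> stops j t \<omega>" using r q by force
    qed
  next
    assume A': ?A'
    show ?A
      unfolding before
    proof (intro ballI impI)
      fix q :: real assume "\<exists>t\<in>?S. t < q"
      then have "?\<tau> < q" unfolding \<tau> using cInf_lower[OF _ bdd] by force
      then obtain t where "?\<tau> \<le> t" "t < q" "stops j t \<omega>" using A'[rule_format, of "q - ?\<tau>"] by auto
      moreover have "0 \<le> ?\<tau>" unfolding \<tau> using ne by (intro cInf_greatest) auto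
      ultimately show "\<exists>r\<in>\<rat> \<inter> {0..<q}. stops j r \<omega>"
        using stops_before_iff_rational[OF \<omega> j, of q] by force
    qed
  qed
  moreover have "?S \<noteq> {} \<longleftrightarrow> terminates m \<theta> \<alpha> \<beta> f X \<omega>" by (auto simp: terminates_def)
  ultimately show ?thesis unfolding T using j by (auto simp: accepts_def)
qed

lemma rejects_measurable: "{\<omega> \<in> space N. rejects m \<theta> \<alpha> \<beta> f X i \<omega>} \<in> sets N"
proof -
  have Q: "countable (\<rat> \<inter> {0..<q})" for q :: real using countable_rat by (intro countable_Int1)
  have before: "{\<omega> \<in> space N. \<exists>r\<in>\<rat> \<inter> {0..<q}. stops k r \<omega>} \<in> sets N" if "k < m" for k q
    using that by (intro sets.sets_Collect_countable_Ex' stops_measurable Q) auto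
  have before_any: "{\<omega> \<in> space N. \<exists>k\<in>{..<m}. \<exists>r\<in>\<rat> \<inter> {0..<q}. stops k r \<omega>} \<in> sets N" for q
    by (intro sets.sets_Collect_finite_Ex before) auto
  have "{\<omega> \<in> space N. (\<exists>q\<in>\<rat>. \<exists>k\<in>{..<m}. \<exists>r\<in>\<rat> \<inter> {0..<q}. stops k r \<omega>) \<and>
      (\<forall>q\<in>\<rat>. (\<exists>k\<in>{..<m}. \<exists>r\<in>\<rat> \<inter> {0..<q}. stops k r \<omega>) \<longrightarrow> (\<exists>r\<in>\<rat> \<inter> {0..<q}. stops j r \<omega>))}
      \<in> sets N" if "j < m" for j
    using countable_rat that
    by (intro sets.sets_Collect_conj sets.sets_Collect_countable_Ex' sets.sets_Collect_countable_All'
        sets.sets_Collect_imp before before_any)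
  then have "{\<omega> \<in> space N. accepts m \<theta> \<alpha> \<beta> f X j \<omega>} \<in> sets N" if "j < m" for j
    using that by (simp add: accepts_iff[OF _ that] Bex_def cong: conj_cong)
  then have "{\<omega> \<in> space N. \<exists>j\<in>{..<m} - {i}. accepts m \<theta> \<alpha> \<beta> f X j \<omega>} \<in> sets N"
    by (intro sets.sets_Collect_finite_Ex) auto
  moreover have "rejects m \<theta> \<alpha> \<beta> f X i \<omega> \<longleftrightarrow> (\<exists>j\<in>{..<m} - {i}. accepts m \<theta> \<alpha> \<beta> f X j \<omega>)" for \<omega>
    by (auto simp: rejects_def accepts_def)
  ultimately show ?thesis by simp
qed

section \<open>Error probabilities\<close>

text \<open>Only one inequality of the stopping condition for the accepted \<open>j\<close> is kept: the one that
  compares \<open>i\<close> with its neighbour on the side of \<open>j\<close>.\<close>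

lemma rejects_imp_beaten:
  assumes "i < m" and "rejects m \<theta> \<alpha> \<beta> f X i \<omega>"
  shows "(i + 1 < m \<and> (\<exists>t\<ge>0. hyp_lik i t \<omega> < \<alpha> (i + 1) * hyp_lik (i + 1) t \<omega>)) \<or>
    (1 \<le> i \<and> (\<exists>t\<ge>0. hyp_lik i t \<omega> < \<beta> i * hyp_lik (i - 1) t \<omega>))"
proof -
  let ?\<tau> = "stop_time m \<theta> \<alpha> \<beta> f X \<omega>"
  obtain j where j: "j \<noteq> i" "accepts m \<theta> \<alpha> \<beta> f X j \<omega>" using assms(2) by (auto simp: rejects_def)
  then have jm: "j < m" by (simp add: accepts_def)
  have "0 \<le> ?\<tau>" unfolding stop_time_def
    using j(2) by (intro cInf_greatest) (auto simp: accepts_def terminates_def)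
  moreover obtain t where "?\<tau> \<le> t" and stop: "stops j t \<omega>"
    using j(2) zero_less_one[where 'a = real] unfolding accepts_def by blast
  ultimately have t: "0 \<le> t" by simp
  note stop = stop[unfolded stops_iff[OF jm t]]
  show ?thesis
  proof (cases "i < j")
    case True
    then have "hyp_lik (i + 1 - 1) t \<omega> < \<alpha> (i + 1) * hyp_lik (i + 1) t \<omega>"
      using stop by (intro bspec[OF conjunct1[OF stop], of "i + 1"]) auto
    then show ?thesis using True jm t by auto
  next
    case False
    then show ?thesis using stop assms(1) j(1) t by auto
  qed
qed

text \<open>Each of the two events gets its own maximal inequality. For \<open>i = m - 1\<close> or
  \<open>i = 0\<close> there is no neighbour on one side, and the corresponding event is empty, in keeping
  with \<open>\<alpha> m = 0\<close> and \<open>\<beta> 0 = 0\<close>.\<close>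

lemma rejects_prob_le:
  assumes i: "i < m" and \<alpha>_m: "\<alpha> m = 0" and \<beta>_0: "\<beta> 0 = 0"
  shows "measure (M (\<theta> i)) {\<omega> \<in> space N. rejects m \<theta> \<alpha> \<beta> f X i \<omega>} \<le> \<alpha> (i + 1) + \<beta> i"
proof -
  interpret P: prob_space "M (\<theta> i)" by (rule prob[OF hyps_in[OF i]])
  define A where "A = {\<omega> \<in> space N. i + 1 < m \<and> (\<exists>t\<ge>0. hyp_lik i t \<omega> < \<alpha> (i + 1) * hyp_lik (i + 1) t \<omega>)}"
  define B where "B = {\<omega> \<in> space N. 1 \<le> i \<and> (\<exists>t\<ge>0. hyp_lik i t \<omega> < \<beta> i * hyp_lik (i - 1) t \<omega>)}"
  have A: "A \<in> sets N \<and> measure (M (\<theta> i)) A \<le> \<alpha> (i + 1)"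
  proof (cases "i + 1 < m")
    case True
    then show ?thesis
      using maximal_inequality[OF hyps_in[OF i] hyps_in[OF True], of "\<alpha> (i + 1)"] \<alpha>[of "i + 1"]
      by (simp add: A_def)
  next
    case False
    with i have "i + 1 = m" by simp
    then show ?thesis by (simp add: A_def \<alpha>_m)
  qed
  have B: "B \<in> sets N \<and> measure (M (\<theta> i)) B \<le> \<beta> i"
  proof (cases "1 \<le> i")
    case True
    then show ?thesis
      using maximal_inequality[OF hyps_in[OF i] hyps_in[of "i - 1"], of "\<beta> i"] \<beta>[of i] i
      by (simp add: B_def)
  next
    case False
    then have "i = 0" by simp
    then show ?thesis by (simp add: B_def \<beta>_0)
  qed
  have "measure (M (\<theta> i)) {\<omega> \<in> space N. rejects m \<theta> \<alpha> \<beta> f X i \<omega>} \<le> measure (M (\<theta> i)) (A \<union> B)"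
  proof (rule P.finite_measure_mono)
    show "{\<omega> \<in> space N. rejects m \<theta> \<alpha> \<beta> f X i \<omega>} \<subseteq> A \<union> B"
      unfolding A_def B_def using rejects_imp_beaten[OF i] by blast
    show "A \<union> B \<in> P.events" using A B by (simp add: events[OF hyps_in[OF i]] sets.Un)
  qed
  also have "\<dots> \<le> measure (M (\<theta> i)) A + measure (M (\<theta> i)) B"
    using A B by (intro measure_Un_le) (simp_all add: events[OF hyps_in[OF i]])
  finally show ?thesis using A B by linarith
qed

section \<open>Termination\<close>

text \<open>Conclusive ratios are ascents or descents of the likelihood. Unimodality forbids an ascent
  after a descent, so the index just before the first descent, or the last index if there is none,
  satisfies the stopping condition.\<close>

lemma unimodal_conclusive_stops:
  assumes mono: "strict_mono_on {..<m} \<theta>" and m: "0 < m" and t: "0 \<le> t"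
    and unimodal: "unimodal_on \<Theta> (\<lambda>\<theta>. f t (X t \<omega>) \<theta>)"
    and conclusive: "\<And>i. i \<in> {1..<m} \<Longrightarrow>
      hyp_lik (i - 1) t \<omega> < \<alpha> i * hyp_lik i t \<omega> \<or> hyp_lik i t \<omega> < \<beta> i * hyp_lik (i - 1) t \<omega>"
  shows "\<exists>j<m. stops j t \<omega>"
proof -
  let ?up = "\<lambda>i. hyp_lik (i - 1) t \<omega> < \<alpha> i * hyp_lik i t \<omega>"
  let ?down = "\<lambda>i. hyp_lik i t \<omega> < \<beta> i * hyp_lik (i - 1) t \<omega>"
  have nonneg: "0 \<le> hyp_lik i t \<omega>" if "i < m" for i
    using likelihood_nonneg[OF hyps_in[OF that] t] .
  have mono_le: "\<theta> i \<le> \<theta> k" if "i \<le> k" "k < m" for i k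
    using strict_mono_onD[OF mono, of i k] that by (cases "i = k") auto
  have up: "hyp_lik (i - 1) t \<omega> < hyp_lik i t \<omega>" if "?up i" "i \<in> {1..<m}" for i
    using that mult_right_mono[of "\<alpha> i" 1 "hyp_lik i t \<omega>"] \<alpha>[of i] nonneg[of i] by auto
  have down: "hyp_lik i t \<omega> < hyp_lik (i - 1) t \<omega>" if "?down i" "i \<in> {1..<m}" for i
    using that mult_right_mono[of "\<beta> i" 1 "hyp_lik (i - 1) t \<omega>"] \<beta>[of i] nonneg[of "i - 1"] by auto
  have persist: "?down k" if "?down i" "i \<in> {1..<m}" "k \<in> {i<..<m}" for i k
  proof (rule ccontr)
    assume "\<not> ?down k"
    then have "?up k" using conclusive[of k] that by auto
    then have "hyp_lik (k - 1) t \<omega> < hyp_lik k t \<omega>" using up that by auto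
    moreover have "hyp_lik k t \<omega> \<le> hyp_lik (k - 1) t \<omega>"
    proof (rule unimodal_no_ascent_after_descent[OF unimodal])
      show "hyp_lik i t \<omega> < hyp_lik (i - 1) t \<omega>" using down that by blast
      show "\<theta> (i - 1) \<in> \<Theta>" "\<theta> i \<in> \<Theta>" "\<theta> (k - 1) \<in> \<Theta>" "\<theta> k \<in> \<Theta>"
        using that(2,3) by (auto intro: hyps_in)
      show "\<theta> (i - 1) \<le> \<theta> i" "\<theta> i \<le> \<theta> (k - 1)" "\<theta> (k - 1) \<le> \<theta> k"
        using that(2,3) by (auto intro: mono_le)
    qed
    ultimately show False by simp
  qed
  show ?thesis
  proof (cases "\<exists>i\<in>{1..<m}. ?down i")
    case True
    define d where "d = (LEAST i. i \<in> {1..<m} \<and> ?down i)"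
    have d: "d \<in> {1..<m} \<and> ?down d" unfolding d_def by (rule LeastI_ex) (use True in blast)
    have "?up i" if "i \<in> {1..d - 1}" for i
    proof -
      have "i < d" using that by auto
      then have "\<not> ?down i"
        using not_less_Least[of i "\<lambda>i. i \<in> {1..<m} \<and> ?down i", folded d_def] that d by auto
      then show ?thesis using conclusive[of i] that d by auto
    qed
    moreover have "?down i" if "i \<in> {d - 1<..<m}" for i
      using d that persist[of d i] by (cases "i = d") auto
    ultimately have "stops (d - 1) t \<omega>" using d t by (subst stops_iff) auto
    then show ?thesis using d by (intro exI[of _ "d - 1"]) auto
  next
    case False
    have "stops (m - 1) t \<omega>" using m t conclusive False by (subst stops_iff) fastforce+
    then show ?thesis using m by (intro exI[of _ "m - 1"]) auto
  qed
qed

text \<open>If sampling never ends, then some ratio is inconclusive at each of the times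
  \<open>1, 2, \<dots>\<close>, that is, the path lies in every \<open>B n\<close>. The probability of \<open>B n\<close> tends to
  \<open>0\<close> by the union bound.\<close>

lemma terminates_AE:
  assumes mono: "strict_mono_on {..<m} \<theta>" and m: "0 < m" and \<xi>: "\<xi> \<in> \<Theta>"
    and unimodal: "\<And>t \<omega>. 0 < t \<Longrightarrow> \<omega> \<in> space N \<Longrightarrow> unimodal_on \<Theta> (\<lambda>\<theta>. f t (X t \<omega>) \<theta>)"
    and lim: "\<And>i. i \<in> {1..<m} \<Longrightarrow>
      ((\<lambda>t. \<P>(\<omega> in M \<xi>. ereal (\<beta> i) \<le> lik_ratio f t (X t \<omega>) (\<theta> (i - 1)) (\<theta> i) \<and>
                          lik_ratio f t (X t \<omega>) (\<theta> (i - 1)) (\<theta> i) \<le> ereal (1 / \<alpha> i))) \<longlongrightarrow> 0) at_top"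
  shows "AE \<omega> in M \<xi>. terminates m \<theta> \<alpha> \<beta> f X \<omega>"
proof -
  interpret P: prob_space "M \<xi>" by (rule prob[OF \<xi>])
  define U where "U i t = {\<omega> \<in> space N. ereal (\<beta> i) \<le> lik_ratio f t (X t \<omega>) (\<theta> (i - 1)) (\<theta> i) \<and>
    lik_ratio f t (X t \<omega>) (\<theta> (i - 1)) (\<theta> i) \<le> ereal (1 / \<alpha> i)}" for i t
  \<comment> \<open>The successor keeps the times positive, as the unimodality assumption requires.\<close>
  define B where "B n = (\<Union>i\<in>{1..<m}. U i (real (Suc n)))" for n
  have U_iff: "U i t = {\<omega> \<in> space N. \<not> hyp_lik (i - 1) t \<omega> < \<alpha> i * hyp_lik i t \<omega> \<and>
      \<not> hyp_lik i t \<omega> < \<beta> i * hyp_lik (i - 1) t \<omega>}" if "i \<in> {1..<m}" "0 \<le> t" for i t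
  proof -
    have i: "1 \<le> i" "i < m" using that(1) by auto
    show ?thesis
      unfolding U_def not_less[symmetric] ratio_gt_iff[OF i that(2)] ratio_less_iff[OF i that(2)]
      by blast
  qed
  have U_sets: "U i t \<in> sets (M \<xi>)" if "i \<in> {1..<m}" "0 \<le> t" for i t
  proof -
    have [measurable]: "hyp_lik i t \<in> borel_measurable N" "hyp_lik (i - 1) t \<in> borel_measurable N"
      using that by (auto intro!: path_likelihood_measurable hyps_in)
    have "U i t \<in> sets N" unfolding U_iff[OF that] by measurable
    then show ?thesis by (simp add: events \<xi>)
  qed
  have B_sets: "B n \<in> sets (M \<xi>)" for n
    unfolding B_def by (intro sets.finite_UN U_sets) auto
  have "(\<lambda>n. \<Sum>i\<in>{1..<m}. measure (M \<xi>) (U i (real (Suc n)))) \<longlonglongrightarrow> (\<Sum>i\<in>{1..<m}. 0)"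
  proof (rule tendsto_sum)
    fix i assume "i \<in> {1..<m}"
    then have "((\<lambda>t. measure (M \<xi>) (U i t)) \<longlongrightarrow> 0) at_top"
      using lim by (simp add: U_def space_M[OF \<xi>])
    moreover have "filterlim (\<lambda>n. real (Suc n)) at_top sequentially"
      by (rule filterlim_compose[OF filterlim_real_sequentially filterlim_Suc])
    ultimately show "(\<lambda>n. measure (M \<xi>) (U i (real (Suc n)))) \<longlonglongrightarrow> 0"
      by (rule filterlim_compose)
  qed
  moreover have "measure (M \<xi>) (\<Inter>n. B n) \<le> (\<Sum>i\<in>{1..<m}. measure (M \<xi>) (U i (real (Suc n))))" for n
  proof -
    have "measure (M \<xi>) (\<Inter>n. B n) \<le> measure (M \<xi>) (B n)"
      using B_sets by (intro P.finite_measure_mono) auto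
    also have "\<dots> \<le> (\<Sum>i\<in>{1..<m}. measure (M \<xi>) (U i (real (Suc n))))"
      unfolding B_def using U_sets by (intro P.finite_measure_subadditive_finite) auto
    finally show ?thesis .
  qed
  ultimately have "measure (M \<xi>) (\<Inter>n. B n) \<le> 0"
    by (intro LIMSEQ_le_const) auto
  then have "measure (M \<xi>) (\<Inter>n. B n) = 0" by (intro antisym measure_nonneg)
  then have "(\<Inter>n. B n) \<in> null_sets (M \<xi>)"
    using B_sets by (intro null_setsI) (auto simp: P.emeasure_eq_measure)
  moreover have "{\<omega> \<in> space (M \<xi>). \<not> terminates m \<theta> \<alpha> \<beta> f X \<omega>} \<subseteq> (\<Inter>n. B n)"
  proof (intro subsetI INT_I)
    fix \<omega> n assume "\<omega> \<in> {\<omega> \<in> space (M \<xi>). \<not> terminates m \<theta> \<alpha> \<beta> f X \<omega>}"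
    then have \<omega>: "\<omega> \<in> space N" and no_stop: "\<not> (\<exists>j<m. stops j (real (Suc n)) \<omega>)"
      unfolding terminates_def space_M[OF \<xi>] using of_nat_0_le_iff by blast+
    obtain i where "i \<in> {1..<m}" "\<not> hyp_lik (i - 1) (real (Suc n)) \<omega> < \<alpha> i * hyp_lik i (real (Suc n)) \<omega>"
      "\<not> hyp_lik i (real (Suc n)) \<omega> < \<beta> i * hyp_lik (i - 1) (real (Suc n)) \<omega>"
      using unimodal_conclusive_stops[OF mono m _ unimodal, of "real (Suc n)" \<omega>] \<omega> no_stop by force
    then show "\<omega> \<in> B n" using \<omega> by (auto simp: B_def U_iff)
  qed
  ultimately show ?thesis by (rule AE_I')
qed

end

theorem theorem11:
  fixes \<Theta> :: "real set"
    and N :: "'a measure"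
    and M :: "real \<Rightarrow> 'a measure"
    and X :: "real \<Rightarrow> 'a \<Rightarrow> real"
    and f :: "real \<Rightarrow> real \<Rightarrow> real \<Rightarrow> real"
    and kind :: law_kind
    and m :: nat
    and \<theta>\<^sub>h \<alpha> \<beta> :: "nat \<Rightarrow> real"
  assumes prob: "\<And>\<theta>. \<theta> \<in> \<Theta> \<Longrightarrow> prob_space (M \<theta>)"
    and events: "\<And>\<theta>. \<theta> \<in> \<Theta> \<Longrightarrow> sets (M \<theta>) = sets N"
    and paths: "\<And>\<omega>. \<omega> \<in> space N \<Longrightarrow> right_continuous (\<lambda>t. X t \<omega>)"
    and lik: "\<And>\<theta> t. \<theta> \<in> \<Theta> \<Longrightarrow> t \<ge> 0 \<Longrightarrow> is_mass_or_density kind (M \<theta>) (X t) (\<lambda>x. f t x \<theta>)"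
    and lik_right_cont: "\<And>\<theta> x. \<theta> \<in> \<Theta> \<Longrightarrow> right_continuous (\<lambda>t. f t x \<theta>)"
    and lik_path_right_cont:
      "\<And>\<theta> \<omega>. \<theta> \<in> \<Theta> \<Longrightarrow> \<omega> \<in> space N \<Longrightarrow> right_continuous (\<lambda>t. f t (X t \<omega>) \<theta>)"
    and m: "m \<ge> 2"
    and hyps_in: "\<And>i. i < m \<Longrightarrow> \<theta>\<^sub>h i \<in> \<Theta>"
    and hyps_mono: "strict_mono_on {..<m} \<theta>\<^sub>h"
    and \<alpha>: "\<And>i. 1 \<le> i \<Longrightarrow> i < m \<Longrightarrow> \<alpha> i \<in> {0<..<1}"
    and \<beta>: "\<And>i. 1 \<le> i \<Longrightarrow> i < m \<Longrightarrow> \<beta> i \<in> {0<..<1}"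
    and \<alpha>_m: "\<alpha> m = 0"
    and \<beta>_0: "\<beta> 0 = 0"
    and sufficient: "past_given_present_free_of_parameter kind \<Theta> M X f"
  shows "((\<forall>\<theta>\<in>\<Theta>. AE \<omega> in M \<theta>. terminates m \<theta>\<^sub>h \<alpha> \<beta> f X \<omega>) \<longrightarrow>
            (\<forall>i<m. {\<omega> \<in> space (M (\<theta>\<^sub>h i)). rejects m \<theta>\<^sub>h \<alpha> \<beta> f X i \<omega>} \<in> sets (M (\<theta>\<^sub>h i)) \<and>
                   \<P>(\<omega> in M (\<theta>\<^sub>h i). rejects m \<theta>\<^sub>h \<alpha> \<beta> f X i \<omega>) \<le> \<alpha> (i + 1) + \<beta> i))
       \<and> ((\<forall>t>0. \<forall>\<omega>\<in>space N. unimodal_on \<Theta> (\<lambda>\<theta>. f t (X t \<omega>) \<theta>)) \<and>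
          (\<forall>a\<in>{0<..<1}. \<forall>b\<in>{0<..<1}. \<forall>\<theta>\<in>\<Theta>. \<forall>i\<in>{1..<m}.
             ((\<lambda>t. \<P>(\<omega> in M \<theta>. ereal b \<le> lik_ratio f t (X t \<omega>) (\<theta>\<^sub>h (i - 1)) (\<theta>\<^sub>h i) \<and>
                               lik_ratio f t (X t \<omega>) (\<theta>\<^sub>h (i - 1)) (\<theta>\<^sub>h i) \<le> ereal (1 / a)))
               \<longlongrightarrow> 0) at_top)
          \<longrightarrow> (\<forall>\<theta>\<in>\<Theta>. AE \<omega> in M \<theta>. terminates m \<theta>\<^sub>h \<alpha> \<beta> f X \<omega>))"
proof -
  interpret csprt \<Theta> N M X f kind m \<theta>\<^sub>h \<alpha> \<beta>
    by (intro csprt.intro likelihood_process.intro csprt_axioms.intro) (fact prob events lik lik_path_right_cont sufficient hyps_in \<alpha> \<beta>)+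
  show ?thesis
  proof (intro conjI impI allI ballI)
    fix i assume i: "i < m"
    note space = space_M[OF hyps_in[OF i]] and sets = events[OF hyps_in[OF i]]
    show "{\<omega> \<in> space (M (\<theta>\<^sub>h i)). rejects m \<theta>\<^sub>h \<alpha> \<beta> f X i \<omega>} \<in> sets (M (\<theta>\<^sub>h i))"
      unfolding space sets by (rule rejects_measurable)
    show "\<P>(\<omega> in M (\<theta>\<^sub>h i). rejects m \<theta>\<^sub>h \<alpha> \<beta> f X i \<omega>) \<le> \<alpha> (i + 1) + \<beta> i"
      unfolding space by (rule rejects_prob_le[OF i \<alpha>_m \<beta>_0])
  next
    fix \<theta> assume "\<theta> \<in> \<Theta>"
    then show "AE \<omega> in M \<theta>. terminates m \<theta>\<^sub>h \<alpha> \<beta> f X \<omega>" if "(\<forall>t>0. \<forall>\<omega>\<in>space N. unimodal_on \<Theta> (\<lambda>\<theta>. f t (X t \<omega>) \<theta>)) \<and>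
          (\<forall>a\<in>{0<..<1}. \<forall>b\<in>{0<..<1}. \<forall>\<theta>\<in>\<Theta>. \<forall>i\<in>{1..<m}.
             ((\<lambda>t. \<P>(\<omega> in M \<theta>. ereal b \<le> lik_ratio f t (X t \<omega>) (\<theta>\<^sub>h (i - 1)) (\<theta>\<^sub>h i) \<and>
                               lik_ratio f t (X t \<omega>) (\<theta>\<^sub>h (i - 1)) (\<theta>\<^sub>h i) \<le> ereal (1 / a)))
               \<longlongrightarrow> 0) at_top)"
      using that m \<alpha> \<beta> by (intro terminates_AE hyps_mono) auto
  qed
qed

end
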